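(* Every imprimitive strongly regular graph is triply transitive.
   Context: A strongly regular graph $\Gamma$ is imprimitive if $\Gamma$ or its complement is disconnected (equivalently, $\Gamma$ is a disjoint union of at least two cliques of equal size, or a complete multipartite graph with parts of equal size). For $\Gamma=(\Omega,E)$: $A_0=I$, $A_1$ its adjacency matrix, $A_2=J-I-A_1$; for a vertex $\omega$, $E^*_{i,\omega}$ ($i=0,1,2$) is the diagonal matrix whose diagonal is the $\omega$-row of $A_i$; $T_\omega$ is the subalgebra of $M_{|\Omega|}(\mathbb C)$ generated by $A_0,A_1,A_2,E^*_{0,\omega},E^*_{1,\omega},E^*_{2,\omega}$; $T_{0,\omega}$ is the span of all $E^*_{i,\omega}A_jE^*_{k,\omega}$; $\tilde T_\omega$ is the algebra of complex matrices commuting with the permutation matrices of the stabilizer $G_\omega$ in $G=\mathrm{Aut}(\Gamma)$. $\Gamma$ is triply transitive if $G$ is transitive on $\Omega$ and $T_{0,\omega}=T_\omega=\tilde T_\omega$ for some (equivalently every) vertex $\omega$. *)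

theory Defs
  imports "HOL-Analysis.Analysis"
begin

text \<open>
  A graph \<open>\<Gamma> = (\<Omega>, E)\<close> on a nonempty finite vertex set is given by a relation \<open>E\<close> on a
  type \<open>'a\<close> of class \<^class>\<open>finite\<close>, with \<open>\<Omega> = UNIV\<close>.
\<close>

section \<open>Strongly regular graphs\<close>

definition simple_graph :: "('a \<Rightarrow> 'a \<Rightarrow> bool) \<Rightarrow> bool" where
  "simple_graph E \<longleftrightarrow> symp E \<and> irreflp E"

definition neighbours :: "('a \<Rightarrow> 'a \<Rightarrow> bool) \<Rightarrow> 'a \<Rightarrow> 'a set" where
  "neighbours E x = {y. E x y}"

definition graph_complement :: "('a \<Rightarrow> 'a \<Rightarrow> bool) \<Rightarrow> 'a \<Rightarrow> 'a \<Rightarrow> bool" where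
  "graph_complement E x y \<longleftrightarrow> x \<noteq> y \<and> \<not> E x y"

definition graph_connected :: "('a \<Rightarrow> 'a \<Rightarrow> bool) \<Rightarrow> bool" where
  "graph_connected E \<longleftrightarrow> (\<forall>x y. E\<^sup>*\<^sup>* x y)"

definition srg :: "('a::finite \<Rightarrow> 'a \<Rightarrow> bool) \<Rightarrow> nat \<Rightarrow> nat \<Rightarrow> nat \<Rightarrow> nat \<Rightarrow> bool" where
  "srg E n k l m \<longleftrightarrow> simple_graph E \<and> CARD('a) = n
     \<and> (\<forall>x. card (neighbours E x) = k)
     \<and> (\<forall>x y. E x y \<longrightarrow> card (neighbours E x \<inter> neighbours E y) = l)
     \<and> (\<forall>x y. graph_complement E x y \<longrightarrow> card (neighbours E x \<inter> neighbours E y) = m)"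

text \<open>
  Complete and edgeless graphs are not excluded (some authors do exclude them): they are the
  complete multipartite graphs with parts of size 1 and the disjoint unions of cliques of size 1.
\<close>
definition strongly_regular :: "('a::finite \<Rightarrow> 'a \<Rightarrow> bool) \<Rightarrow> bool" where
  "strongly_regular E \<longleftrightarrow> (\<exists>n k l m. srg E n k l m)"

definition imprimitive :: "('a \<Rightarrow> 'a \<Rightarrow> bool) \<Rightarrow> bool" where
  "imprimitive E \<longleftrightarrow> \<not> graph_connected E \<or> \<not> graph_connected (graph_complement E)"

section \<open>Automorphisms\<close>

definition graph_aut :: "('a \<Rightarrow> 'a \<Rightarrow> bool) \<Rightarrow> ('a \<Rightarrow> 'a) set" where
  "graph_aut E = {g. bij g \<and> (\<forall>x y. E (g x) (g y) \<longleftrightarrow> E x y)}"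

definition aut_stabilizer :: "('a \<Rightarrow> 'a \<Rightarrow> bool) \<Rightarrow> 'a \<Rightarrow> ('a \<Rightarrow> 'a) set" where
  "aut_stabilizer E w = {g \<in> graph_aut E. g w = w}"

definition vertex_transitive :: "('a \<Rightarrow> 'a \<Rightarrow> bool) \<Rightarrow> bool" where
  "vertex_transitive E \<longleftrightarrow> (\<forall>x y. \<exists>g \<in> graph_aut E. g x = y)"

section \<open>Complex matrix algebras\<close>

type_synonym 'a cmatrix = "complex ^ 'a ^ 'a"

definition cscale :: "complex \<Rightarrow> 'a::finite cmatrix \<Rightarrow> 'a cmatrix" where
  "cscale c A = (\<chi> i j. c * A $ i $ j)"

text \<open>
  The library's \<^const>\<open>span\<close> on matrices is the real span; the complex one is \<open>cmat.span\<close>.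
\<close>
global_interpretation cmat: vector_space "cscale :: complex \<Rightarrow> 'a::finite cmatrix \<Rightarrow> 'a cmatrix"
  by unfold_locales (simp_all add: cscale_def vec_eq_iff algebra_simps)

definition subalgebra :: "'a::finite cmatrix set \<Rightarrow> bool" where
  "subalgebra S \<longleftrightarrow> cmat.subspace S \<and> mat 1 \<in> S \<and> (\<forall>A\<in>S. \<forall>B\<in>S. A ** B \<in> S)"

definition generated_algebra :: "'a::finite cmatrix set \<Rightarrow> 'a cmatrix set" where
  "generated_algebra X = subalgebra hull X"

definition perm_matrix :: "('a \<Rightarrow> 'a) \<Rightarrow> 'a::finite cmatrix" where
  "perm_matrix g = (\<chi> i j. if i = g j then 1 else 0)"

section \<open>Terwilliger algebras and triple transitivity\<close>

definition adj_matrix :: "('a \<Rightarrow> 'a \<Rightarrow> bool) \<Rightarrow> 'a::finite cmatrix" where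
  "adj_matrix E = (\<chi> x y. if E x y then 1 else 0)"

definition all_ones :: "'a::finite cmatrix" where
  "all_ones = (\<chi> x y. 1)"

text \<open>The matrices \<open>A\<^sub>0\<close>, \<open>A\<^sub>1\<close>, \<open>A\<^sub>2\<close>; only indices \<open>i \<le> 2\<close> are ever used.\<close>
definition assoc_matrix :: "('a \<Rightarrow> 'a \<Rightarrow> bool) \<Rightarrow> nat \<Rightarrow> 'a::finite cmatrix" where
  "assoc_matrix E i =
     (if i = 0 then mat 1
      else if i = 1 then adj_matrix E
      else if i = 2 then all_ones - mat 1 - adj_matrix E
      else 0)"

definition dual_idempotent :: "('a \<Rightarrow> 'a \<Rightarrow> bool) \<Rightarrow> 'a \<Rightarrow> nat \<Rightarrow> 'a::finite cmatrix" where
  "dual_idempotent E w i = (\<chi> x y. if x = y then assoc_matrix E i $ w $ x else 0)"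

text \<open>The three algebras are \<open>T\<^sub>\<omega>\<close>, \<open>T\<^sub>0\<^sub>,\<^sub>\<omega>\<close> (in general only a subspace), and the centralizer
  algebra of the vertex stabilizer.\<close>
definition terwilliger_algebra :: "('a \<Rightarrow> 'a \<Rightarrow> bool) \<Rightarrow> 'a \<Rightarrow> 'a::finite cmatrix set" where
  "terwilliger_algebra E w =
     generated_algebra (assoc_matrix E ` {0..2} \<union> dual_idempotent E w ` {0..2})"

definition terwilliger_space0 :: "('a \<Rightarrow> 'a \<Rightarrow> bool) \<Rightarrow> 'a \<Rightarrow> 'a::finite cmatrix set" where
  "terwilliger_space0 E w =
     cmat.span {dual_idempotent E w i ** assoc_matrix E j ** dual_idempotent E w k | i j k.
                i \<in> {0..2} \<and> j \<in> {0..2} \<and> k \<in> {0..2}}"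

definition stabilizer_centralizer :: "('a \<Rightarrow> 'a \<Rightarrow> bool) \<Rightarrow> 'a \<Rightarrow> 'a::finite cmatrix set" where
  "stabilizer_centralizer E w =
     {M. \<forall>g \<in> aut_stabilizer E w. M ** perm_matrix g = perm_matrix g ** M}"

definition triply_transitive :: "('a::finite \<Rightarrow> 'a \<Rightarrow> bool) \<Rightarrow> bool" where
  "triply_transitive E \<longleftrightarrow> vertex_transitive E
     \<and> (\<exists>w. terwilliger_space0 E w = terwilliger_algebra E w
            \<and> terwilliger_algebra E w = stabilizer_centralizer E w)"

end

theory Submission
  imports Defs
begin

text \<open>
  An imprimitive strongly regular graph or its complement is a disjoint union of cliques of equal
  size. Such a graph is homogeneous: every isomorphism between induced subgraphs extends to an
  automorphism, one vertex at a time. Applied to at most three vertices, this says that the group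
  is vertex transitive and that the orbits of a vertex stabilizer \<open>G\<^sub>\<omega>\<close> on pairs \<open>(x, y)\<close> are
  determined by the relations in which \<open>(\<omega>, x)\<close>, \<open>(x, y)\<close>, \<open>(\<omega>, y)\<close> lie. The matrices
  \<open>E\<^sup>*\<^sub>i A\<^sub>j E\<^sup>*\<^sub>k\<close> are the indicator matrices of these orbits, so their span is
  the whole centralizer algebra.
\<close>

section \<open>Homogeneous graphs\<close>

text \<open>This encodes an isomorphism from the subgraph induced on \<open>A\<close> to the one
  induced on its image; the values of \<open>f\<close> outside \<open>A\<close> do not
  matter.\<close>

definition partial_aut :: "('a \<Rightarrow> 'a \<Rightarrow> bool) \<Rightarrow> 'a set \<Rightarrow> ('a \<Rightarrow> 'a) \<Rightarrow> bool" where
  "partial_aut E A f \<longleftrightarrow> inj_on f A \<and> (\<forall>x\<in>A. \<forall>y\<in>A. E (f x) (f y) \<longleftrightarrow> E x y)"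

definition homogeneous :: "('a \<Rightarrow> 'a \<Rightarrow> bool) \<Rightarrow> bool" where
  "homogeneous E \<longleftrightarrow> (\<forall>A f. partial_aut E A f \<longrightarrow> (\<exists>g\<in>graph_aut E. \<forall>x\<in>A. g x = f x))"

lemma graph_complement_complement:
  assumes "simple_graph E"
  shows "graph_complement (graph_complement E) = E"
  using assms by (auto simp: fun_eq_iff graph_complement_def simple_graph_def irreflp_def)

lemma simple_graph_complement:
  "simple_graph E \<Longrightarrow> simple_graph (graph_complement E)"
  by (auto simp: graph_complement_def simple_graph_def irreflp_def symp_def)

text \<open>A bijection preserves adjacency iff it preserves non-adjacency of distinct vertices, and
  likewise for injections on \<open>A\<close>. This reduces the case of a disconnected complement to
  that of a disconnected graph.\<close>

lemma homogeneous_complement: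
  assumes "simple_graph E" and "homogeneous (graph_complement E)"
  shows "homogeneous E"
  unfolding homogeneous_def
proof (intro allI impI)
  fix A f
  assume f: "partial_aut E A f"
  then have "partial_aut (graph_complement E) A f"
    by (auto simp: partial_aut_def graph_complement_def inj_on_eq_iff)
  then obtain g where g: "g \<in> graph_aut (graph_complement E)" "\<forall>x\<in>A. g x = f x"
    using assms(2) unfolding homogeneous_def by blast
  have "E (g x) (g y) \<longleftrightarrow> E x y" for x y
  proof (cases "x = y")
    case True
    then show ?thesis using assms(1) by (auto simp: simple_graph_def irreflp_def)
  next
    case False
    moreover from this have "g x \<noteq> g y"
      using g(1) by (auto simp: graph_aut_def bij_def inj_eq)
    moreover have "graph_complement E (g x) (g y) \<longleftrightarrow> graph_complement E x y"
      using g(1) by (simp add: graph_aut_def)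
    ultimately show ?thesis by (simp add: graph_complement_def)
  qed
  then show "\<exists>g\<in>graph_aut E. \<forall>x\<in>A. g x = f x"
    using g by (auto simp: graph_aut_def)
qed

lemma partial_aut_extend_point:
  fixes E :: "'a::finite \<Rightarrow> 'a \<Rightarrow> bool"
  assumes E: "simple_graph E"
    and equiv: "equivp (\<lambda>x y. x = y \<or> E x y)"
    and card_class: "\<And>x. card {y. x = y \<or> E x y} = c"
    and f: "partial_aut E A f" and a: "a \<notin> A"
  obtains b where "b \<notin> f ` A" "\<And>x. x \<in> A \<Longrightarrow> E b (f x) \<longleftrightarrow> E a x"
proof -
  define R where "R x y \<longleftrightarrow> x = y \<or> E x y" for x y
  have R_refl: "R x x" for x by (simp add: R_def)
  have R_sym: "R x y \<Longrightarrow> R y x" for x y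
    using equivp_symp[OF equiv] unfolding R_def by blast
  have R_trans: "R x y \<Longrightarrow> R y z \<Longrightarrow> R x z" for x y z
    using equivp_transp[OF equiv] unfolding R_def by blast
  have cls_eq: "Collect (R x) = Collect (R y) \<longleftrightarrow> R x y" for x y
    using R_refl R_sym R_trans by blast
  have inj: "inj_on f A" and fE: "x \<in> A \<Longrightarrow> y \<in> A \<Longrightarrow> E (f x) (f y) \<longleftrightarrow> E x y" for x y
    using f by (auto simp: partial_aut_def)
  have fR: "R (f x) (f y) \<longleftrightarrow> R x y" if "x \<in> A" "y \<in> A" for x y
    using that fE inj by (auto simp: R_def inj_on_eq_iff)
  have card_R: "card (Collect (R x)) = c" for x
    using card_class[of x] unfolding R_def by simp
  have "\<exists>b. b \<notin> f ` A \<and> (\<forall>x\<in>A. R b (f x) \<longleftrightarrow> R a x)"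
  proof (cases "\<exists>x\<in>A. R a x")
    case True
    then obtain x where x: "x \<in> A" "R a x" by blast
    \<comment> \<open>Inside the clique of \<open>f x\<close>, the used vertices come from the
      clique of \<open>x\<close> within \<open>A\<close>. That set misses \<open>a\<close>, so fewer
      than \<open>c\<close> vertices are used.\<close>
    have "Collect (R (f x)) \<inter> f ` A = f ` (Collect (R x) \<inter> A)"
      using fR x(1) by auto
    then have "card (Collect (R (f x)) \<inter> f ` A) \<le> card (Collect (R x) \<inter> A)"
      by (simp add: card_image_le)
    also have "\<dots> < card (Collect (R x))"
      using x a R_sym by (intro psubset_card_mono) auto
    finally have "\<not> Collect (R (f x)) \<subseteq> f ` A"
      using card_R by (metis inf.absorb1 less_irrefl)
    then obtain b where b: "R (f x) b" "b \<notin> f ` A" by blast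
    have "R b (f y) \<longleftrightarrow> R a y" if "y \<in> A" for y
      using fR[OF x(1) that] b(1) x(2) R_sym R_trans by meson
    with b(2) show ?thesis by blast
  next
    case False
    let ?cls = "\<lambda>x. Collect (R x)"
    \<comment> \<open>\<open>h\<close> is the map on cliques induced by \<open>f\<close>, through a
      chosen representative; it is meaningful only on cliques meeting \<open>A\<close>. It bounds
      the number of cliques met by the image by the number met by \<open>A\<close>.\<close>
    define h where "h C = ?cls (f (SOME x. x \<in> A \<and> ?cls x = C))" for C
    have "?cls (f x) = h (?cls x)" if "x \<in> A" for x
    proof -
      let ?y = "SOME y. y \<in> A \<and> ?cls y = ?cls x"
      have "?y \<in> A \<and> ?cls ?y = ?cls x"
        by (rule someI[of _ x]) (use that in simp)
      then show ?thesis
        unfolding h_def using cls_eq fR that by metis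
    qed
    then have "?cls ` f ` A = h ` ?cls ` A"
      by (auto simp: image_image)
    then have "card (?cls ` f ` A) \<le> card (?cls ` A)"
      by (simp add: card_image_le)
    also have "?cls a \<notin> ?cls ` A"
      using False cls_eq by blast
    then have "card (?cls ` A) < card (range ?cls)"
      by (intro psubset_card_mono) auto
    finally have "\<not> range ?cls \<subseteq> ?cls ` f ` A"
      by (meson card_mono finite leD)
    then obtain b where b: "?cls b \<notin> ?cls ` f ` A" by blast
    then have nb: "\<forall>y\<in>A. \<not> R b (f y)" using cls_eq by blast
    then have "b \<notin> f ` A" using R_refl by blast
    with nb False show ?thesis by blast
  qed
  then obtain b where b: "b \<notin> f ` A" "\<forall>x\<in>A. R b (f x) \<longleftrightarrow> R a x" by blast
  show ?thesis
  proof
    show "b \<notin> f ` A" by fact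
    \<comment> \<open>Since \<open>b\<close> is outside the image and \<open>a\<close> outside
      \<open>A\<close>, equality is excluded on both sides and \<open>R\<close> reduces to
      \<open>E\<close>.\<close>
    show "E b (f x) \<longleftrightarrow> E a x" if "x \<in> A" for x
      using b that a E unfolding R_def simple_graph_def irreflp_def by (metis imageI)
  qed
qed

lemma homogeneous_equal_cliques:
  fixes E :: "'a::finite \<Rightarrow> 'a \<Rightarrow> bool"
  assumes E: "simple_graph E"
    and equiv: "equivp (\<lambda>x y. x = y \<or> E x y)"
    and card_class: "\<And>x. card {y. x = y \<or> E x y} = c"
  shows "homogeneous E"
proof -
  have "\<exists>g\<in>graph_aut E. \<forall>x\<in>A. g x = f x" if "partial_aut E A f" for A f
    using that
  \<comment> \<open>Induction on the number of vertices where the map is still undetermined. When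
    none is left, injectivity on a finite type gives bijectivity.\<close>
  proof (induction "card (- A)" arbitrary: A f)
    case 0
    then have "A = UNIV" by auto
    with 0 have "f \<in> graph_aut E"
      by (auto simp: partial_aut_def graph_aut_def bij_def finite_UNIV_inj_surj)
    then show ?case by blast
  next
    case (Suc n)
    then obtain a where a: "a \<notin> A" by (metis ComplD card.empty ex_in_conv nat.distinct(1))
    obtain b where b: "b \<notin> f ` A" "\<And>x. x \<in> A \<Longrightarrow> E b (f x) \<longleftrightarrow> E a x"
      using partial_aut_extend_point[OF E equiv card_class Suc.prems a] by blast
    have b': "E (f x) b \<longleftrightarrow> E x a" if "x \<in> A" for x
      using b(2)[OF that] E unfolding simple_graph_def symp_def by blast
    have irr: "\<not> E x x" for x using E by (auto simp: simple_graph_def irreflp_def)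
    have "- insert a A = - A - {a}" by auto
    then have "n = card (- insert a A)" using Suc.hyps(2) a by simp
    moreover have "partial_aut E (insert a A) (f(a := b))"
      using Suc.prems a b b' irr unfolding partial_aut_def inj_on_def
      by (auto simp: image_iff)
    ultimately obtain g where g: "g \<in> graph_aut E" "\<forall>x\<in>insert a A. g x = (f(a := b)) x"
      using Suc.hyps(1) by blast
    then show ?case using a by (intro bexI[of _ g]) auto
  qed
  then show ?thesis by (simp add: homogeneous_def)
qed

section \<open>Imprimitive strongly regular graphs\<close>

text \<open>If \<open>m\<close> were positive, any two distinct non-adjacent vertices would be
  joined by a path of length 2. So \<open>m\<close> is 0, which makes adjacency-or-equality
  transitive, and regularity gives every clique the size \<open>k + 1\<close>.\<close>

lemma homogeneous_if_disconnected:
  fixes E :: "'a::finite \<Rightarrow> 'a \<Rightarrow> bool"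
  assumes E: "simple_graph E"
    and deg: "\<And>x. card (neighbours E x) = k"
    and mu: "\<And>x y. graph_complement E x y \<Longrightarrow> card (neighbours E x \<inter> neighbours E y) = m"
    and disc: "\<not> graph_connected E"
  shows "homogeneous E"
proof -
  have sym: "E x y \<Longrightarrow> E y x" and irr: "\<not> E x x" for x y
    using E by (auto simp: simple_graph_def symp_def irreflp_def)
  have m0: "m = 0"
  proof (rule ccontr)
    assume m: "m \<noteq> 0"
    have "E\<^sup>*\<^sup>* x y" for x y
    proof (cases "graph_complement E x y")
      case True
      then have "neighbours E x \<inter> neighbours E y \<noteq> {}" using mu m by fastforce
      then obtain z where "E x z" "E z y" using sym by (auto simp: neighbours_def)
      then show ?thesis by (meson r_into_rtranclp rtranclp.rtrancl_into_rtrancl)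
    next
      case False
      then show ?thesis by (auto simp: graph_complement_def)
    qed
    with disc show False by (simp add: graph_connected_def)
  qed
  have trans: "x = z \<or> E x z" if "E x y" "E y z" for x y z
  proof (rule ccontr)
    assume "\<not> ?thesis"
    then have "card (neighbours E x \<inter> neighbours E z) = 0"
      using mu m0 by (simp add: graph_complement_def)
    then show False using that sym by (auto simp: neighbours_def)
  qed
  have "card {y. x = y \<or> E x y} = Suc k" for x
  proof -
    have "{y. x = y \<or> E x y} = insert x (neighbours E x)"
      by (auto simp: neighbours_def)
    then show ?thesis using deg irr by (simp add: neighbours_def)
  qed
  moreover have "equivp (\<lambda>x y. x = y \<or> E x y)"
    using sym trans by (intro equivpI reflpI sympI transpI) blast+
  ultimately show ?thesis using homogeneous_equal_cliques[OF E] by blast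
qed

lemma homogeneous_if_imprimitive:
  fixes E :: "'a::finite \<Rightarrow> 'a \<Rightarrow> bool"
  assumes "strongly_regular E" and "imprimitive E"
  shows "homogeneous E"
proof -
  obtain n k l m where E: "simple_graph E" and n: "CARD('a) = n"
    and k: "\<And>x. card (neighbours E x) = k"
    and l: "\<And>x y. E x y \<Longrightarrow> card (neighbours E x \<inter> neighbours E y) = l"
    and m: "\<And>x y. graph_complement E x y \<Longrightarrow> card (neighbours E x \<inter> neighbours E y) = m"
    using assms(1) unfolding strongly_regular_def srg_def by metis
  show ?thesis
  proof (cases "graph_connected E")
    case False
    then show ?thesis using homogeneous_if_disconnected[OF E k m] by blast
  next
    case True
    then have disc: "\<not> graph_connected (graph_complement E)"
      using assms(2) by (simp add: imprimitive_def)
    have nb: "neighbours (graph_complement E) x = - insert x (neighbours E x)" for x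
      by (auto simp: neighbours_def graph_complement_def)
    have "card (neighbours (graph_complement E) x) = n - Suc k" for x
    proof -
      have "x \<notin> neighbours E x"
        using E by (auto simp: neighbours_def simple_graph_def irreflp_def)
      then show ?thesis unfolding nb using k n by (simp add: Compl_eq_Diff_UNIV card_Diff_subset)
    qed
    moreover have "card (neighbours (graph_complement E) x \<inter> neighbours (graph_complement E) y)
        = n - (2 * k - l)" if "graph_complement (graph_complement E) x y" for x y
    proof -
      have xy: "E x y" "E y x" using that graph_complement_complement[OF E] E
        by (auto simp: simple_graph_def symp_def)
      \<comment> \<open>Non-adjacency in the complement means adjacency in \<open>E\<close>, so
        \<open>x\<close> and \<open>y\<close> already lie in the union of the two neighbourhoods and
        need not be removed separately.\<close>
      then have "neighbours (graph_complement E) x \<inter> neighbours (graph_complement E) y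
          = - (neighbours E x \<union> neighbours E y)"
        unfolding nb by (auto simp: neighbours_def)
      moreover have "card (neighbours E x \<union> neighbours E y) = 2 * k - l"
        using card_Un_Int[of "neighbours E x" "neighbours E y"] k l[OF xy(1)] by simp
      ultimately show ?thesis using n by (simp add: Compl_eq_Diff_UNIV card_Diff_subset)
    qed
    ultimately have "homogeneous (graph_complement E)"
      using homogeneous_if_disconnected[OF simple_graph_complement[OF E] _ _ disc] by blast
    then show ?thesis using homogeneous_complement[OF E] by blast
  qed
qed

section \<open>Orbits of vertex stabilizers and the Terwilliger algebra\<close>

definition rel_index :: "('a \<Rightarrow> 'a \<Rightarrow> bool) \<Rightarrow> 'a \<Rightarrow> 'a \<Rightarrow> nat" where
  "rel_index E x y = (if x = y then 0 else if E x y then 1 else 2)"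

lemma rel_index_le: "rel_index E x y \<le> 2"
  by (simp add: rel_index_def)

lemma assoc_matrix_nth:
  assumes "simple_graph E" "i \<le> 2"
  shows "assoc_matrix E i $ x $ y = (if rel_index E x y = i then 1 else 0)"
proof -
  have "i = 0 \<or> i = 1 \<or> i = 2" using assms(2) by auto
  moreover have "\<not> E x x" using assms(1) by (auto simp: simple_graph_def irreflp_def)
  ultimately show ?thesis
    by (auto simp: assoc_matrix_def rel_index_def mat_def adj_matrix_def all_ones_def)
qed

lemma rel_index_aut: "g \<in> graph_aut E \<Longrightarrow> rel_index E (g x) (g y) = rel_index E x y"
  by (auto simp: rel_index_def graph_aut_def bij_def inj_eq)

text \<open>The indices determine the induced subgraph on a labelled triple, so triples with equal
  indices are matched by a partial automorphism, which homogeneity extends.\<close>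

lemma homogeneous_rel_index:
  assumes E: "simple_graph E" and hom: "homogeneous E"
    and wx: "rel_index E w x = rel_index E w' x'"
    and xy: "rel_index E x y = rel_index E x' y'"
    and wy: "rel_index E w y = rel_index E w' y'"
  obtains g where "g \<in> graph_aut E" "g w = w'" "g x = x'" "g y = y'"
proof -
  \<comment> \<open>The vertices may coincide. Index 0 records equality, so both triples have the
    same coincidences and the overlapping cases agree.\<close>
  define f where "f z = (if z = w then w' else if z = x then x' else y')" for z
  have eq_iff: "rel_index E u v = rel_index E u' v' \<Longrightarrow>
      (u' = v' \<longleftrightarrow> u = v) \<and> (E u' v' \<longleftrightarrow> E u v) \<and> (E v' u' \<longleftrightarrow> E v u)" for u v u' v'
    using E by (auto simp: rel_index_def simple_graph_def symp_def irreflp_def split: if_splits)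
  have irr: "\<not> E u u" for u using E by (auto simp: simple_graph_def irreflp_def)
  have f: "f w = w'" "f x = x'" "f y = y'"
    using eq_iff[OF wx] eq_iff[OF xy] eq_iff[OF wy] by (auto simp: f_def)
  have "partial_aut E {w, x, y} f"
    unfolding partial_aut_def inj_on_def
    using eq_iff[OF wx] eq_iff[OF xy] eq_iff[OF wy] irr by (auto simp: f)
  then obtain g where "g \<in> graph_aut E" "\<forall>z\<in>{w, x, y}. g z = f z"
    using hom unfolding homogeneous_def by blast
  then show ?thesis using that f by auto
qed

section \<open>Invariance under the vertex stabilizer and inclusions between the three
  algebras\<close>

lemma commutes_perm_matrix_iff:
  fixes M :: "'a::finite cmatrix"
  assumes "bij g"
  shows "M ** perm_matrix g = perm_matrix g ** M \<longleftrightarrow> (\<forall>x y. M $ g x $ g y = M $ x $ y)"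
proof -
  have L: "(M ** perm_matrix g) $ u $ v = M $ u $ g v" for u v
    by (simp add: matrix_matrix_mult_def perm_matrix_def if_distrib cong: if_cong)
  have R: "(perm_matrix g ** M) $ g u $ v = M $ u $ v" for u v
  proof -
    have "g u = g z \<longleftrightarrow> u = z" for z using assms by (auto simp: bij_def inj_eq)
    then show ?thesis
      by (simp add: matrix_matrix_mult_def perm_matrix_def if_distrib if_distribR cong: if_cong)
  qed
  have "M ** perm_matrix g = perm_matrix g ** M \<longleftrightarrow>
      (\<forall>u v. (M ** perm_matrix g) $ u $ v = (perm_matrix g ** M) $ u $ v)"
    by (simp add: vec_eq_iff)
  \<comment> \<open>By surjectivity every row has the form \<open>g u\<close>, and in such rows the
    left product by the permutation matrix is explicit.\<close>
  also have "\<dots> \<longleftrightarrow> (\<forall>u v. (M ** perm_matrix g) $ g u $ v = (perm_matrix g ** M) $ g u $ v)"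
    using bij_is_surj[OF assms] by (metis surjD)
  finally show ?thesis by (simp add: L R)
qed

lemma stabilizer_centralizer_iff:
  "M \<in> stabilizer_centralizer E w \<longleftrightarrow>
     (\<forall>g\<in>aut_stabilizer E w. \<forall>x y. M $ g x $ g y = M $ x $ y)"
  unfolding stabilizer_centralizer_def
  by (auto simp: aut_stabilizer_def graph_aut_def commutes_perm_matrix_iff)

lemma subalgebra_stabilizer_centralizer:
  fixes E :: "'a::finite \<Rightarrow> 'a \<Rightarrow> bool"
  shows "subalgebra (stabilizer_centralizer E w)"
  unfolding subalgebra_def
proof (intro conjI ballI)
  show "cmat.subspace (stabilizer_centralizer E w)"
    by (auto simp: cmat.subspace_def stabilizer_centralizer_iff cscale_def)
  show "mat 1 \<in> stabilizer_centralizer E w"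
    by (simp add: stabilizer_centralizer_def)
  fix A B
  assume "A \<in> stabilizer_centralizer E w" "B \<in> stabilizer_centralizer E w"
  then show "A ** B \<in> stabilizer_centralizer E w"
    unfolding stabilizer_centralizer_def mem_Collect_eq by (metis matrix_mul_assoc)
qed

text \<open>The hull is itself a subalgebra because intersections of subalgebras are
  subalgebras.\<close>

lemma subalgebra_terwilliger: "subalgebra (terwilliger_algebra E w)"
  unfolding terwilliger_algebra_def generated_algebra_def
  by (rule hull_in) (auto simp: subalgebra_def cmat.subspace_def)

lemma terwilliger_generators:
  "assoc_matrix E ` {0..2} \<union> dual_idempotent E w ` {0..2} \<subseteq> terwilliger_algebra E w"
  unfolding terwilliger_algebra_def generated_algebra_def by (rule hull_subset)

lemma terwilliger_space0_subset: "terwilliger_space0 E w \<subseteq> terwilliger_algebra E w"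
  unfolding terwilliger_space0_def
proof (rule cmat.span_minimal)
  show "cmat.subspace (terwilliger_algebra E w)"
    using subalgebra_terwilliger by (auto simp: subalgebra_def)
  have "\<And>A B. A \<in> terwilliger_algebra E w \<Longrightarrow> B \<in> terwilliger_algebra E w \<Longrightarrow>
      A ** B \<in> terwilliger_algebra E w"
    using subalgebra_terwilliger by (auto simp: subalgebra_def)
  then show "{dual_idempotent E w i ** assoc_matrix E j ** dual_idempotent E w k | i j k.
      i \<in> {0..2} \<and> j \<in> {0..2} \<and> k \<in> {0..2}} \<subseteq> terwilliger_algebra E w"
    using terwilliger_generators[of E w] by (fastforce simp: image_subset_iff)
qed

text \<open>The centralizer is an algebra, so only generators need checking. Automorphisms preserve
  the relation of a pair, and those fixing \<open>w\<close> also preserve the relation of a vertex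
  to \<open>w\<close>.\<close>

lemma terwilliger_algebra_subset:
  assumes E: "simple_graph E"
  shows "terwilliger_algebra E w \<subseteq> stabilizer_centralizer E w"
  unfolding terwilliger_algebra_def generated_algebra_def
proof (rule hull_minimal)
  show "subalgebra (stabilizer_centralizer E w)"
    by (rule subalgebra_stabilizer_centralizer)
  have A: "assoc_matrix E i $ g x $ g y = assoc_matrix E i $ x $ y"
    if "g \<in> aut_stabilizer E w" "i \<le> 2" for g i x y
    using that rel_index_aut[of g E x y] by (simp add: assoc_matrix_nth[OF E] aut_stabilizer_def)
  have D: "dual_idempotent E w i $ g x $ g y = dual_idempotent E w i $ x $ y"
    if g: "g \<in> aut_stabilizer E w" "i \<le> 2" for g i x y
  proof -
    have "g w = w" "g x = g y \<longleftrightarrow> x = y"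
      using g by (auto simp: aut_stabilizer_def graph_aut_def bij_def inj_eq)
    then show ?thesis using A[OF g, of w x] by (auto simp: dual_idempotent_def)
  qed
  show "assoc_matrix E ` {0..2} \<union> dual_idempotent E w ` {0..2} \<subseteq> stabilizer_centralizer E w"
    using A D by (auto simp: stabilizer_centralizer_iff)
qed

text \<open>The outer factors are diagonal and select rows and columns by their relation to
  \<open>w\<close>; the product is thus an indicator matrix.\<close>

lemma terwilliger_triple_product_nth:
  assumes "simple_graph E" "i \<le> 2" "j \<le> 2" "k \<le> 2"
  shows "(dual_idempotent E w i ** assoc_matrix E j ** dual_idempotent E w k) $ x $ y =
    (if rel_index E w x = i \<and> rel_index E x y = j \<and> rel_index E w y = k then 1 else 0)"
proof -
  have "(dual_idempotent E w i ** A ** dual_idempotent E w k) $ x $ y =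
      assoc_matrix E i $ w $ x * A $ x $ y * assoc_matrix E k $ w $ y" for A
    by (simp add: matrix_matrix_mult_def dual_idempotent_def if_distrib if_distribR cong: if_cong)
  then show ?thesis using assms by (simp add: assoc_matrix_nth)
qed

text \<open>A matrix in the centralizer is constant on the stabilizer orbits of pairs. By
  homogeneity these are the nonempty index classes, whose indicators are the triple products, so the
  matrix is a combination of them.\<close>

lemma stabilizer_centralizer_subset:
  fixes E :: "'a::finite \<Rightarrow> 'a \<Rightarrow> bool"
  assumes E: "simple_graph E" and hom: "homogeneous E"
  shows "stabilizer_centralizer E w \<subseteq> terwilliger_space0 E w"
proof
  fix M
  assume M: "M \<in> stabilizer_centralizer E w"
  define P where "P i j k p \<longleftrightarrow> rel_index E w (fst p) = i \<and> rel_index E (fst p) (snd p) = j \<and>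
    rel_index E w (snd p) = k" for i j k p
  \<comment> \<open>The coefficient is the entry of \<open>M\<close> at a chosen pair with these
    indices. If there is no such pair its value is arbitrary, but the matching triple product is
    zero.\<close>
  define c where "c i j k = (let p = SOME p. P i j k p in M $ fst p $ snd p)" for i j k
  have c: "c (rel_index E w x) (rel_index E x y) (rel_index E w y) = M $ x $ y" for x y
  proof -
    let ?Q = "P (rel_index E w x) (rel_index E x y) (rel_index E w y)"
    define p where "p = (SOME p. ?Q p)"
    have "?Q p" unfolding p_def by (rule someI[of _ "(x, y)"]) (simp add: P_def)
    then obtain g where g: "g \<in> graph_aut E" "g w = w" "g x = fst p" "g y = snd p"
      using homogeneous_rel_index[OF E hom, of w x w "fst p" y "snd p"] unfolding P_def by metis
    then have "M $ g x $ g y = M $ x $ y"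
      using M unfolding stabilizer_centralizer_iff aut_stabilizer_def by blast
    with g show ?thesis by (simp add: c_def p_def Let_def)
  qed
  let ?T = "\<lambda>i j k. dual_idempotent E w i ** assoc_matrix E j ** dual_idempotent E w k"
  have "M = (\<Sum>i\<in>{0..2}. \<Sum>j\<in>{0..2}. \<Sum>k\<in>{0..2}. cscale (c i j k) (?T i j k))"
  proof -
    have "(\<Sum>i\<in>{0..2}. \<Sum>j\<in>{0..2}. \<Sum>k\<in>{0..2}. cscale (c i j k) (?T i j k)) $ x $ y = M $ x $ y"
      for x y
    proof -
      let ?a = "rel_index E w x" and ?b = "rel_index E x y" and ?d = "rel_index E w y"
      \<comment> \<open>The indicator is written as nested conditionals, with the test on
        \<open>k\<close> outermost, so that the sums collapse from the innermost outwards.\<close>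
      have "(\<Sum>i\<in>{0..2}. \<Sum>j\<in>{0..2}. \<Sum>k\<in>{0..2}. cscale (c i j k) (?T i j k)) $ x $ y =
        (\<Sum>i\<in>{0..2}. \<Sum>j\<in>{0..2}. \<Sum>k\<in>{0..2}.
          if ?d = k then (if ?b = j then (if ?a = i then c i j k else 0) else 0) else 0)"
        unfolding sum_component
        by (intro sum.cong refl) (auto simp: cscale_def terwilliger_triple_product_nth[OF E])
      also have "\<dots> = c ?a ?b ?d"
        using rel_index_le[of E] by simp
      finally show ?thesis by (simp add: c)
    qed
    then show ?thesis by (simp add: vec_eq_iff)
  qed
  also have "\<dots> \<in> terwilliger_space0 E w"
    unfolding terwilliger_space0_def
    by (intro cmat.span_sum cmat.span_scale cmat.span_base) blast
  finally show "M \<in> terwilliger_space0 E w" .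
qed

theorem theorem5p3:
  fixes E :: "'a::finite \<Rightarrow> 'a \<Rightarrow> bool"
  assumes "strongly_regular E" and "imprimitive E"
  shows "triply_transitive E"
proof -
  have E: "simple_graph E" using assms(1) by (auto simp: strongly_regular_def srg_def)
  have hom: "homogeneous E" using homogeneous_if_imprimitive[OF assms] .
  \<comment> \<open>The constant triples at \<open>x\<close> and at \<open>y\<close> have all
    indices 0.\<close>
  have "\<exists>g\<in>graph_aut E. g x = y" for x y
    using homogeneous_rel_index[OF E hom, of x x y y x y] by (auto simp: rel_index_def)
  then have "vertex_transitive E" by (simp add: vertex_transitive_def)
  \<comment> \<open>Equality follows from a cycle of three inclusions, valid at every vertex
    \<open>w\<close>.\<close>
  moreover have "terwilliger_space0 E w = terwilliger_algebra E w \<and>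
      terwilliger_algebra E w = stabilizer_centralizer E w" for w
    using terwilliger_space0_subset[of E w] terwilliger_algebra_subset[OF E, of w]
      stabilizer_centralizer_subset[OF E hom, of w] by blast
  ultimately show ?thesis by (simp add: triply_transitive_def)
qed

end
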